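(* Every definably complete uniformly locally o-minimal expansion of the second kind $\mathcal R=(R,<,+,0,\ldots)$ of a densely linearly ordered abelian group is definably Baire.
   Context: "Definable" means definable in $\mathcal R$ with parameters; $R^n$ has the product order topology. Definably complete: every definable subset of $R$ has supremum and infimum in $R\cup\{\pm\infty\}$. Locally o-minimal: for every definable $X\subset R$ and $a\in R$ there is an open interval $I\ni a$ with $X\cap I$ a finite union of points and open intervals. Uniformly locally o-minimal of the second kind: locally o-minimal, and for every $n\ge1$, definable $X\subset R^{n+1}$, $a\in R$, $b\in R^n$ there exist an open interval $I\ni a$ and open box $B\ni b$ with $\{t:(y,t)\in X\}\cap I$ a finite union of points and open intervals for all $y\in B$. A parameterized family is the family of fibers of a definable set. A definable increasing family $\{X_r\}_{r>0}$ is a parameterized family indexed by positive $r$ with $X_r\subset X_{r'}$ whenever $0<r<r'$. $\mathcal R$ is definably Baire if for every definable increasing family $\{X_r\}_{r>0}$ of subsets of some $R^n$ with $\operatorname{int}(\overline{X_r})=\emptyset$ for all $r$, the union $\bigcup_{r>0}X_r$ has empty interior. *)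

theory Defs
  imports
    "HOL-Analysis.Function_Topology"
    "HOL-Library.Extended"
    "HOL-Library.Lub_Glb"
begin

text \<open>
  First-order expansions \<open>(R, <, +, 0, \<dots>)\<close>, where \<open>R\<close> is the carrier type \<open>'a\<close>. The symbols
  \<open><\<close>, \<open>+\<close>, \<open>0\<close> are built into the syntax; the types \<open>'f\<close> and \<open>'r\<close> supply arbitrary further
  function and relation symbols. These symbols carry no arity: they are interpreted on argument
  lists, so a symbol applied to \<open>k\<close> arguments plays the role of a \<open>k\<close>-ary symbol, one for each \<open>k\<close>.
  A symbol of fixed arity is recovered by interpreting it as \<open>0\<close> (respectively false) on
  lists of any other length, which makes no further set definable.
\<close>

datatype 'f fo_term =
    Var nat
  | Zero
  | Plus "'f fo_term" "'f fo_term"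
  | App 'f "'f fo_term list"

datatype ('f, 'r) fo_formula =
    Equal "'f fo_term" "'f fo_term"
  | Less "'f fo_term" "'f fo_term"
  | Rel 'r "'f fo_term list"
  | Neg "('f, 'r) fo_formula"
  | Conj "('f, 'r) fo_formula" "('f, 'r) fo_formula"
  | Exists nat "('f, 'r) fo_formula"

record ('a, 'f, 'r) expansion =
  fun_interp :: "'f \<Rightarrow> 'a list \<Rightarrow> 'a"
  rel_interp :: "'r \<Rightarrow> 'a list \<Rightarrow> bool"

primrec eval_term ::
  "('a::linordered_ab_group_add, 'f, 'r) expansion \<Rightarrow> (nat \<Rightarrow> 'a) \<Rightarrow> 'f fo_term \<Rightarrow> 'a" where
  "eval_term M e (Var i) = e i"
| "eval_term M e Zero = 0"
| "eval_term M e (Plus s t) = eval_term M e s + eval_term M e t"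
| "eval_term M e (App f ts) = fun_interp M f (map (eval_term M e) ts)"

primrec sat ::
  "('a::linordered_ab_group_add, 'f, 'r) expansion \<Rightarrow> (nat \<Rightarrow> 'a) \<Rightarrow> ('f, 'r) fo_formula \<Rightarrow> bool" where
  "sat M e (Equal s t) \<longleftrightarrow> eval_term M e s = eval_term M e t"
| "sat M e (Less s t) \<longleftrightarrow> eval_term M e s < eval_term M e t"
| "sat M e (Rel r ts) \<longleftrightarrow> rel_interp M r (map (eval_term M e) ts)"
| "sat M e (Neg p) \<longleftrightarrow> \<not> sat M e p"
| "sat M e (Conj p q) \<longleftrightarrow> sat M e p \<and> sat M e q"
| "sat M e (Exists i p) \<longleftrightarrow> (\<exists>a. sat M (e(i := a)) p)"

text \<open>
  \<open>R\<^sup>n\<close> consists of the functions on \<open>{0, \<dots>, n - 1}\<close>, extended by \<^term>\<open>undefined\<close>. For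
  \<open>y\<close> in \<open>R\<^sup>n\<close> and \<open>t\<close> in \<open>R\<close>, the point \<open>(y, t)\<close> of \<open>R\<^sup>n\<^sup>+\<^sup>1\<close> is \<open>y(n := t)\<close>.
\<close>

definition power_space :: "nat \<Rightarrow> (nat \<Rightarrow> 'a) set" where
  "power_space n = {..<n} \<rightarrow>\<^sub>E UNIV"

text \<open>On the class \<^class>\<open>linorder_topology\<close>, \<^term>\<open>euclidean\<close> is the order topology.\<close>

definition power_topology :: "nat \<Rightarrow> (nat \<Rightarrow> 'a::linorder_topology) topology" where
  "power_topology n = product_topology (\<lambda>_. euclidean) {..<n}"

text \<open>
  The values \<open>e i\<close> with \<open>i \<ge> n\<close> are the parameters; only finitely many of them occur in \<open>p\<close>.
\<close>

definition definable ::
  "('a::linordered_ab_group_add, 'f, 'r) expansion \<Rightarrow> nat \<Rightarrow> (nat \<Rightarrow> 'a) set \<Rightarrow> bool" where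
  "definable M n X \<longleftrightarrow>
    (\<exists>(p :: ('f, 'r) fo_formula) e.
       X = {x \<in> power_space n. sat M (\<lambda>i. if i < n then x i else e i) p})"

definition definable_subset ::
  "('a::linordered_ab_group_add, 'f, 'r) expansion \<Rightarrow> 'a set \<Rightarrow> bool" where
  "definable_subset M Y \<longleftrightarrow> definable M 1 {x \<in> power_space 1. x 0 \<in> Y}"

text \<open>
  Endpoints lie in \<open>R \<union> {\<plusminus>\<infinity>}\<close>. The empty interval is allowed; this is harmless, since below intervals
  either are required to contain a point or occur as members of a union.
\<close>

definition open_interval :: "'a::linorder set \<Rightarrow> bool" where
  "open_interval I \<longleftrightarrow> (\<exists>c d :: 'a extended. I = {x. c < Fin x \<and> Fin x < d})"

definition open_box :: "nat \<Rightarrow> (nat \<Rightarrow> 'a::linorder) set \<Rightarrow> bool" where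
  "open_box n B \<longleftrightarrow> (\<exists>J. (\<forall>i<n. open_interval (J i)) \<and> B = Pi\<^sub>E {..<n} J)"

definition finite_union_points_intervals :: "'a::linorder set \<Rightarrow> bool" where
  "finite_union_points_intervals S \<longleftrightarrow>
    (\<exists>F. finite F \<and> (\<forall>J\<in>F. (\<exists>a. J = {a}) \<or> open_interval J) \<and> S = \<Union>F)"

definition definably_complete ::
  "('a::linordered_ab_group_add, 'f, 'r) expansion \<Rightarrow> bool" where
  "definably_complete M \<longleftrightarrow>
    (\<forall>Y. definable_subset M Y \<longrightarrow>
       (\<exists>s :: 'a extended. isLub UNIV (Fin ` Y) s) \<and>
       (\<exists>i :: 'a extended. isGlb UNIV (Fin ` Y) i))"

definition locally_o_minimal ::
  "('a::linordered_ab_group_add, 'f, 'r) expansion \<Rightarrow> bool" where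
  "locally_o_minimal M \<longleftrightarrow>
    (\<forall>X a. definable_subset M X \<longrightarrow>
       (\<exists>I. open_interval I \<and> a \<in> I \<and> finite_union_points_intervals (X \<inter> I)))"

definition uniformly_locally_o_minimal_second_kind ::
  "('a::linordered_ab_group_add, 'f, 'r) expansion \<Rightarrow> bool" where
  "uniformly_locally_o_minimal_second_kind M \<longleftrightarrow>
    locally_o_minimal M \<and>
    (\<forall>n\<ge>1. \<forall>X a. \<forall>b\<in>power_space n. definable M (Suc n) X \<longrightarrow>
       (\<exists>I B. open_interval I \<and> a \<in> I \<and> open_box n B \<and> b \<in> B \<and>
          (\<forall>y\<in>B. finite_union_points_intervals ({t. y(n := t) \<in> X} \<inter> I))))"

text \<open>Only the members \<open>X r\<close> with \<open>r > 0\<close> belong to the family.\<close>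

definition definable_increasing_family ::
  "('a::linordered_ab_group_add, 'f, 'r) expansion \<Rightarrow> nat \<Rightarrow> ('a \<Rightarrow> (nat \<Rightarrow> 'a) set) \<Rightarrow> bool" where
  "definable_increasing_family M n X \<longleftrightarrow>
    (\<exists>A. definable M (Suc n) A \<and> (\<forall>r>0. X r = {x \<in> power_space n. x(n := r) \<in> A})) \<and>
    (\<forall>r r'. 0 < r \<and> r < r' \<longrightarrow> X r \<subseteq> X r')"

definition definably_baire ::
  "('a::{linordered_ab_group_add, linorder_topology}, 'f, 'r) expansion \<Rightarrow> bool" where
  "definably_baire M \<longleftrightarrow>
    (\<forall>n X. definable_increasing_family M n X \<longrightarrow>
       (\<forall>r>0. power_topology n interior_of (power_topology n closure_of X r) = {}) \<longrightarrow>
       power_topology n interior_of (\<Union>r\<in>{0<..}. X r) = {})"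

end

theory Submission
  imports Defs
begin

text \<open>
  It suffices that a chain of definable sets covering an open box has a member containing an open
  box; this is shown by induction on the dimension.

  On an interval \<open>(a, b)\<close>, suppose no member contains an interval. By local o-minimality the members
  are then closed and discrete. Let \<open>D\<close> consist of the points that are the least element to the
  right of \<open>a\<close> of some member. It accumulates at \<open>a\<close>, hence contains an interval \<open>(a, e)\<close>. If
  \<open>y < x\<close> are in \<open>(a, e)\<close>, the member with least element \<open>x\<close> omits \<open>y\<close>, so it lies in every member
  containing \<open>y\<close>; thus a member containing \<open>y\<close> contains \<open>(y, e)\<close>.

  In the step, every fibre over the base is covered, so over a smaller base some fixed member has
  intervals in all its fibres. To make one interval work for all fibres, iterated right germs at the
  corner of a box are used as an ultrafilter of definable sets: by the induction hypothesis its
  members contain boxes.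
\<close>

section \<open>Definable predicates\<close>

primrec rename_term :: "(nat \<Rightarrow> nat) \<Rightarrow> 'f fo_term \<Rightarrow> 'f fo_term" where
  "rename_term s (Var i) = Var (s i)"
| "rename_term s Zero = Zero"
| "rename_term s (Plus t u) = Plus (rename_term s t) (rename_term s u)"
| "rename_term s (App f ts) = App f (map (rename_term s) ts)"

lemma eval_rename_term: "eval_term M e (rename_term s t) = eval_term M (\<lambda>i. e (s i)) t"
proof (induction t)
  case (App f ts)
  then have "map (eval_term M e \<circ> rename_term s) ts = map (eval_term M (\<lambda>i. e (s i))) ts"
    by (simp add: o_def)
  then show ?case by (simp add: o_def del: map_eq_conv)
qed auto

text \<open>Bound variables are renamed to indices outside the range of \<open>s\<close>, so \<open>s\<close> need not be
  injective.\<close>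

lemma sat_rename:
  fixes M :: "('a::linordered_ab_group_add, 'f, 'r) expansion" and p :: "('f, 'r) fo_formula"
  assumes "infinite (- range s)"
  shows "\<exists>q :: ('f, 'r) fo_formula. \<forall>e. sat M e q \<longleftrightarrow> sat M (\<lambda>i. e (s i)) p"
  using assms
proof (induction p arbitrary: s)
  case (Equal t u)
  show ?case
    by (rule exI[of _ "Equal (rename_term s t) (rename_term s u)"])
      (simp add: eval_rename_term o_def)
next
  case (Less t u)
  show ?case
    by (rule exI[of _ "Less (rename_term s t) (rename_term s u)"])
      (simp add: eval_rename_term o_def)
next
  case (Rel r ts)
  have "map (eval_term M e \<circ> rename_term s) ts = map (eval_term M (\<lambda>i. e (s i))) ts" for e
    by (simp add: eval_rename_term o_def)
  then show ?case
    by (intro exI[of _ "Rel r (map (rename_term s) ts)"]) (simp add: o_def del: map_eq_conv)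
next
  case (Neg p)
  then obtain q :: "('f, 'r) fo_formula" where "\<forall>e. sat M e q \<longleftrightarrow> sat M (\<lambda>i. e (s i)) p" by blast
  then show ?case by (intro exI[of _ "Neg q"]) (simp only: sat.simps simp_thms)
next
  case (Conj p1 p2)
  then obtain q1 q2 :: "('f, 'r) fo_formula"
    where "\<forall>e. sat M e q1 \<longleftrightarrow> sat M (\<lambda>i. e (s i)) p1" "\<forall>e. sat M e q2 \<longleftrightarrow> sat M (\<lambda>i. e (s i)) p2" by metis
  then show ?case by (intro exI[of _ "Conj q1 q2"]) (simp only: sat.simps simp_thms)
next
  case (Exists i p)
  obtain z where z: "z \<notin> range s"
    using Exists.prems by (metis ComplD infinite_imp_nonempty ex_in_conv)
  have "- range s \<subseteq> insert z (- range (s(i := z)))" by auto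
  then have "infinite (- range (s(i := z)))"
    using Exists.prems finite_subset by blast
  then obtain q :: "('f, 'r) fo_formula"
    where q: "\<And>e. sat M e q \<longleftrightarrow> sat M (\<lambda>j. e ((s(i := z)) j)) p" using Exists.IH by blast
  have "(\<lambda>j. (e(z := a)) ((s(i := z)) j)) = (\<lambda>j. e (s j))(i := a)" for e :: "nat \<Rightarrow> 'a" and a
    using z by (auto simp: fun_eq_iff)
  then show ?case by (intro exI[of _ "Exists z q"]) (simp only: sat.simps q simp_thms)
qed

text \<open>Variables take the even indices and parameters the odd ones. Both supplies are infinite,
  so no arity has to be tracked and the parameters of several formulas fit side by side.\<close>

definition mix :: "(nat \<Rightarrow> 'a) \<Rightarrow> (nat \<Rightarrow> 'a) \<Rightarrow> nat \<Rightarrow> 'a" where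
  "mix x e i = (if even i then x (i div 2) else e (i div 2))"

definition dfn :: "('a::linordered_ab_group_add, 'f, 'r) expansion \<Rightarrow> ((nat \<Rightarrow> 'a) \<Rightarrow> bool) \<Rightarrow> bool" where
  "dfn M P \<longleftrightarrow> (\<exists>(p :: ('f, 'r) fo_formula) e. \<forall>x. P x \<longleftrightarrow> sat M (mix x e) p)"

lemma dfn_renamingI:
  fixes M :: "('a::linordered_ab_group_add, 'f, 'r) expansion" and p :: "('f, 'r) fo_formula"
  assumes "infinite (- range s)" and "\<And>x. P x \<longleftrightarrow> sat M (\<lambda>i. mix x e (s i)) p"
  shows "dfn M P"
proof -
  obtain q :: "('f, 'r) fo_formula" where "\<And>e. sat M e q \<longleftrightarrow> sat M (\<lambda>i. e (s i)) p"
    using sat_rename[OF assms(1), of M p] by blast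
  then have "P x \<longleftrightarrow> sat M (mix x e) q" for x using assms(2) by simp
  then show ?thesis unfolding dfn_def by blast
qed

text \<open>Parameters are placed at indices \<open>8 m + 1\<close> and \<open>8 m + 3\<close>, which leaves infinitely many
  indices free.\<close>

lemma infinite_avoiding:
  fixes s :: "nat \<Rightarrow> nat"
  assumes "\<And>i. n \<le> s i \<Longrightarrow> s i mod 8 \<noteq> 5"
  shows "infinite (- range s)"
proof -
  let ?f = "\<lambda>j. 8 * (j + n) + 5 :: nat"
  have "inj ?f" by (simp add: inj_def)
  then have "infinite (range ?f)" using finite_imageD infinite_UNIV_nat by blast
  moreover have "?f j \<noteq> s i" for i j
  proof
    assume "?f j = s i"
    moreover have "n \<le> ?f j" "?f j mod 8 = 5" by presburger+
    ultimately show False using assms[of i] by simp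
  qed
  then have "range ?f \<subseteq> - range s" by (simp add: image_subset_iff image_iff)
  ultimately show ?thesis using finite_subset by blast
qed

lemma index_arith:
  fixes m :: nat
  shows "even m \<Longrightarrow> m mod 8 \<noteq> 5" "(8 * m + 1) mod 8 = 1" "(8 * m + 3) mod 8 = 3"
    "(8 * m + 1) div 2 = 4 * m" "(8 * m + 3) div 2 = 4 * m + 1" "(4 * m + 1) div 4 = m"
    "(8 * m + 1) div 8 = m" "(4 * m + 1) mod 4 = 1" "odd (8 * m + 1)" "odd (8 * m + 3)"
  by presburger+

section \<open>Closure under connectives and quantifiers\<close>

lemma dfn_not:
  fixes M :: "('a::linordered_ab_group_add, 'f, 'r) expansion"
  assumes "dfn M P"
  shows "dfn M (\<lambda>x. \<not> P x)"
proof -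
  obtain p :: "('f, 'r) fo_formula" and e where "\<And>x. P x \<longleftrightarrow> sat M (mix x e) p"
    using assms unfolding dfn_def by blast
  then have "\<not> P x \<longleftrightarrow> sat M (mix x e) (Neg p)" for x by simp
  then show ?thesis unfolding dfn_def by blast
qed

lemma dfn_conj:
  fixes M :: "('a::linordered_ab_group_add, 'f, 'r) expansion"
  assumes "dfn M P" "dfn M Q"
  shows "dfn M (\<lambda>x. P x \<and> Q x)"
proof -
  obtain p q :: "('f, 'r) fo_formula" and d e
    where p: "\<And>x. P x \<longleftrightarrow> sat M (mix x d) p" and q: "\<And>x. Q x \<longleftrightarrow> sat M (mix x e) q"
    using assms unfolding dfn_def by blast
  \<comment> \<open>\<open>s k\<close> fixes the variables and moves parameter number
    \<open>m\<close> to index \<open>8 m + k\<close>. As \<open>mix\<close> halves odd indices,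
    \<open>d m\<close> has to sit at position \<open>4 m\<close> of \<open>c\<close>, and
    \<open>e m\<close> at \<open>4 m + 1\<close>.\<close>
  define s where "s k i = (if even i then i else 8 * (i div 2) + k)" for k i :: nat
  define c where "c i = (if i mod 4 = 0 then d (i div 4) else e (i div 4))" for i
  have "infinite (- range (s 1))" "infinite (- range (s 3))"
    by (rule infinite_avoiding[of 0]; simp add: s_def index_arith del: One_nat_def add_Suc_right)+
  then obtain p' q' :: "('f, 'r) fo_formula"
    where p': "\<And>e. sat M e p' \<longleftrightarrow> sat M (\<lambda>i. e (s 1 i)) p"
      and q': "\<And>e. sat M e q' \<longleftrightarrow> sat M (\<lambda>i. e (s 3 i)) q"
    using sat_rename[of "s 1" M p] sat_rename[of "s 3" M q] by metis
  have "(\<lambda>i. mix x c (s 1 i)) = mix x d" "(\<lambda>i. mix x c (s 3 i)) = mix x e" for x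
    by (auto simp: fun_eq_iff mix_def s_def c_def index_arith simp del: One_nat_def add_Suc_right)
  then have "P x \<and> Q x \<longleftrightarrow> sat M (mix x c) (Conj p' q')" for x
    by (simp only: p q p' q' sat.simps)
  then show ?thesis unfolding dfn_def by blast
qed

lemma dfn_imp:
  assumes "dfn M P" "dfn M Q"
  shows "dfn M (\<lambda>x. P x \<longrightarrow> Q x)"
  using dfn_not[OF dfn_conj[OF assms(1) dfn_not[OF assms(2)]]] by simp

text \<open>Predicates depending on a further variable use de Bruijn indices: the new variable takes
  index \<open>0\<close> and the others are shifted.\<close>

lemma dfn_ex:
  fixes M :: "('a::linordered_ab_group_add, 'f, 'r) expansion"
  assumes "dfn M (\<lambda>x. Q (x 0) (\<lambda>i. x (Suc i)))"
  shows "dfn M (\<lambda>x. \<exists>a. Q a x)"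
proof -
  obtain p :: "('f, 'r) fo_formula" and e
    where p: "\<And>x. Q (x 0) (\<lambda>i. x (Suc i)) \<longleftrightarrow> sat M (mix x e) p"
    using assms unfolding dfn_def by blast
  \<comment> \<open>Variable \<open>0\<close> becomes the bound variable at index \<open>3\<close>,
    the other variables move down by one place (two indices), and parameters go to
    \<open>8 m + 1\<close>, which never equals \<open>3\<close>.\<close>
  define s :: "nat \<Rightarrow> nat" where
    "s j = (if j = 0 then 3 else if even j then j - 2 else 8 * (j div 2) + 1)" for j
  define c where "c i = e (i div 4)" for i
  have "infinite (- range s)"
    by (rule infinite_avoiding[of 0]) (simp add: s_def index_arith del: One_nat_def add_Suc_right)
  then obtain q :: "('f, 'r) fo_formula" where q: "\<And>e. sat M e q \<longleftrightarrow> sat M (\<lambda>i. e (s i)) p"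
    using sat_rename[of s M p] by metis
  have "((mix x c)(3 := a)) (s j) = mix (case_nat a x) e j" for x a j
  proof (cases "even j")
    case True
    then obtain i where "j = 2 * i" by blast
    moreover have "2 * Suc i - 2 = 2 * i" "2 * i \<noteq> 3" for i by presburger+
    ultimately show ?thesis by (cases i) (simp_all add: mix_def s_def del: mult_Suc_right)
  next
    case False
    then show ?thesis by (auto simp: mix_def s_def index_arith c_def simp del: One_nat_def add_Suc_right)
  qed
  then have "(\<lambda>i. ((mix x c)(3 := a)) (s i)) = mix (case_nat a x) e" for x a by auto
  then have "(\<exists>a. Q a x) \<longleftrightarrow> sat M (mix x c) (Exists 3 q)" for x
    using p[of "case_nat _ x"] by (simp add: q del: fun_upd_apply)
  then show ?thesis unfolding dfn_def by blast
qed

lemma dfn_all: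
  assumes "dfn M (\<lambda>x. Q (x 0) (\<lambda>i. x (Suc i)))"
  shows "dfn M (\<lambda>x. \<forall>a. Q a x)"
  using dfn_not[OF dfn_ex[of M "\<lambda>a x. \<not> Q a x", OF dfn_not[OF assms]]] by simp

text \<open>Coordinates and constants can be substituted by renaming alone, a constant becoming a
  new parameter. Sums occur only inside inequalities, through \<open>dfn_less_plus\<close> and
  \<open>dfn_plus_le\<close>.\<close>

definition dvar :: "((nat \<Rightarrow> 'a) \<Rightarrow> 'a) \<Rightarrow> bool" where
  "dvar f \<longleftrightarrow> (\<exists>k. f = (\<lambda>x. x k)) \<or> (\<exists>c. f = (\<lambda>_. c))"

lemma dvar_proj: "dvar (\<lambda>x. x k)" and dvar_const: "dvar (\<lambda>_. c)"
  by (auto simp: dvar_def)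

lemma dvar_case_nat:
  "dvar f \<Longrightarrow> (\<And>j. dvar (g j)) \<Longrightarrow> dvar (\<lambda>x. case_nat (f x) (\<lambda>j. g j x) i)"
  by (cases i) auto

lemma dfn_subst:
  fixes M :: "('a::linordered_ab_group_add, 'f, 'r) expansion"
  assumes "dfn M P" and "\<And>i. dvar (g i)"
  shows "dfn M (\<lambda>x. P (\<lambda>i. g i x))"
proof -
  obtain p :: "('f, 'r) fo_formula" and e where p: "\<And>x. P x \<longleftrightarrow> sat M (mix x e) p"
    using assms unfolding dfn_def by blast
  have "\<forall>i. \<exists>v k c. g i = (\<lambda>x. if v then x k else c)"
    using assms(2) unfolding dvar_def by metis
  then obtain v k c where g: "\<And>i. g i = (\<lambda>x. if v i then x (k i) else c i)" by metis
  \<comment> \<open>Old parameters go to \<open>8 m + 1\<close>, substituted constants to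
    \<open>8 m + 3\<close>. Several variables may be sent to the same coordinate.\<close>
  define s where "s j = (if odd j then 8 * (j div 2) + 1
    else if v (j div 2) then 2 * k (j div 2) else 8 * (j div 2) + 3)" for j
  define d where "d i = (if i mod 4 = 0 then e (i div 4) else c (i div 4))" for i
  show ?thesis
  proof (rule dfn_renamingI)
    show "infinite (- range s)"
      by (rule infinite_avoiding[of 0]) (simp add: s_def index_arith del: One_nat_def add_Suc_right)
    have "mix (\<lambda>i. g i x) e = (\<lambda>i. mix x d (s i))" for x
      by (auto simp: fun_eq_iff mix_def s_def d_def index_arith g simp del: One_nat_def add_Suc_right)
    then show "P (\<lambda>i. g i x) \<longleftrightarrow> sat M (\<lambda>i. mix x d (s i)) p" for x by (simp add: p)
  qed
qed

lemma dfn_less: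
  fixes M :: "('a::linordered_ab_group_add, 'f, 'r) expansion"
  assumes "dvar f" "dvar g"
  shows "dfn M (\<lambda>x. f x < g x)"
proof -
  have "dfn M (\<lambda>x. x 0 < x (Suc 0))"
    unfolding dfn_def by (rule exI[of _ "Less (Var 0) (Var 2)"]) (simp add: mix_def)
  from dfn_subst[OF this, of "\<lambda>i. if i = 0 then f else g"] show ?thesis using assms by simp
qed

lemma dfn_less_plus:
  fixes M :: "('a::linordered_ab_group_add, 'f, 'r) expansion"
  assumes "dvar f" "dvar g" "dvar h"
  shows "dfn M (\<lambda>x. f x < g x + h x)"
proof -
  have "dfn M (\<lambda>x. x 0 < x (Suc 0) + x (Suc (Suc 0)))"
    unfolding dfn_def
    by (rule exI[of _ "Less (Var 0) (Plus (Var 2) (Var 4))"]) (simp add: mix_def flip: numeral_2_eq_2)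
  from dfn_subst[OF this, of "\<lambda>i. if i = 0 then f else if i = Suc 0 then g else h"]
  show ?thesis using assms by simp
qed

lemma dfn_plus_le:
  fixes M :: "('a::linordered_ab_group_add, 'f, 'r) expansion"
  assumes "dvar f" "dvar g" "dvar h"
  shows "dfn M (\<lambda>x. g x + h x \<le> f x)"
  using dfn_not[OF dfn_less_plus[OF assms]] by (simp add: not_less)

lemma dfn_le:
  fixes M :: "('a::linordered_ab_group_add, 'f, 'r) expansion"
  assumes "dvar f" "dvar g"
  shows "dfn M (\<lambda>x. f x \<le> g x)"
  using dfn_not[OF dfn_less[OF assms(2,1)]] by (simp add: not_less)

lemma dfn_family_subst:
  assumes "dfn M (\<lambda>x. X (x 0) (\<lambda>i. x (Suc i)))" and "dvar f" and "\<And>i. dvar (g i)"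
  shows "dfn M (\<lambda>x. X (f x) (\<lambda>i. g i x))"
  using dfn_subst[OF assms(1), of "case_nat f g"] assms(2,3) by (simp split: nat.split)

lemmas dfn_intros = dfn_conj dfn_imp dfn_not dfn_ex dfn_all dfn_less dfn_le dfn_less_plus dfn_plus_le
  dvar_proj dvar_const dvar_case_nat

section \<open>Translation between definable sets and definable predicates\<close>

lemma dfn_of_definable:
  fixes M :: "('a::linordered_ab_group_add, 'f, 'r) expansion"
  assumes "definable M n A"
  shows "dfn M (\<lambda>x. restrict x {..<n} \<in> A)"
proof -
  obtain p :: "('f, 'r) fo_formula" and e
    where A: "A = {x \<in> power_space n. sat M (\<lambda>i. if i < n then x i else e i) p}"
    using assms unfolding definable_def by blast
  define s where "s i = (if i < n then 2 * i else 8 * i + 1)" for i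
  show ?thesis
  proof (rule dfn_renamingI)
    show "infinite (- range s)"
      by (rule infinite_avoiding[of 0]) (simp add: s_def index_arith del: One_nat_def add_Suc_right)
    have "(\<lambda>i. if i < n then restrict x {..<n} i else e i) = (\<lambda>i. mix x (\<lambda>i. e (i div 4)) (s i))" for x
      by (auto simp: fun_eq_iff mix_def s_def index_arith simp del: One_nat_def add_Suc_right)
    then show "restrict x {..<n} \<in> A \<longleftrightarrow> sat M (\<lambda>i. mix x (\<lambda>i. e (i div 4)) (s i)) p" for x
      by (simp add: A power_space_def)
  qed
qed

lemma definable_of_dfn:
  fixes M :: "('a::linordered_ab_group_add, 'f, 'r) expansion"
  assumes "dfn M P"
  shows "definable M n {x \<in> power_space n. P x}"
proof -
  obtain p :: "('f, 'r) fo_formula" and e where p: "\<And>x. P x \<longleftrightarrow> sat M (mix x e) p"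
    using assms unfolding dfn_def by blast
  \<comment> \<open>A variable beyond the first \<open>n\<close> has the value
    \<open>undefined\<close> on \<open>power_space n\<close>, so it is turned into a parameter with
    that value. Adding \<open>n\<close> keeps all parameter indices out of the range of the
    coordinates.\<close>
  define s where "s j = (if odd j then 8 * (j div 2 + n) + 1
    else if j div 2 < n then j div 2 else 8 * (j div 2 + n) + 3)" for j
  define d where "d i = (if i mod 8 = 1 then e (i div 8 - n) else undefined)" for i
  have "infinite (- range s)"
    \<comment> \<open>Indices below \<open>n\<close> carry coordinates and may be 5 modulo 8; only
      those from \<open>n\<close> on have to avoid this residue.\<close>
    by (rule infinite_avoiding[of n])
      (auto simp: s_def index_arith simp del: One_nat_def add_Suc_right distrib_left_numeral
        split: if_splits)
  then obtain q :: "('f, 'r) fo_formula" where q: "\<And>e. sat M e q \<longleftrightarrow> sat M (\<lambda>i. e (s i)) p"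
    using sat_rename[of s M p] by metis
  have "(if s i < n then x (s i) else d (s i)) = mix x e i" if x: "x \<in> power_space n" for x i
  proof -
    let ?m = "i div 2 + n"
    have "\<not> 8 * ?m + 1 < n" "\<not> 8 * ?m + 3 < n" by simp_all
    moreover have "d (8 * ?m + 1) = e (i div 2)" "d (8 * ?m + 3) = undefined"
      unfolding d_def index_arith by simp_all
    moreover have "x (i div 2) = undefined" if "\<not> i div 2 < n"
      using x that unfolding power_space_def by (meson PiE_arb lessThan_iff)
    ultimately show ?thesis
      by (cases "even i"; cases "i div 2 < n") (simp_all only: mix_def s_def if_True if_False simp_thms)
  qed
  then have "sat M (\<lambda>i. if i < n then x i else d i) q \<longleftrightarrow> P x" if "x \<in> power_space n" for x
    using that by (simp only: p q)
  then have "{x \<in> power_space n. P x}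
      = {x \<in> power_space n. sat M (\<lambda>i. if i < n then x i else d i) q}"
    by blast
  then show ?thesis unfolding definable_def by blast
qed

lemma definable_subset_of_dfn:
  assumes "dfn M (\<lambda>x. Q (x 0))"
  shows "definable_subset M {t. Q t}"
  using definable_of_dfn[OF assms, of 1] by (simp add: definable_subset_def)

section \<open>Right germs\<close>

definition rgerm :: "'a::linorder \<Rightarrow> ('a \<Rightarrow> bool) \<Rightarrow> bool" where
  "rgerm c Q \<longleftrightarrow> (\<exists>e>c. \<forall>t. c < t \<and> t < e \<longrightarrow> Q t)"

lemma rgerm_mono: "rgerm c Q \<Longrightarrow> (\<And>t. Q t \<Longrightarrow> Q' t) \<Longrightarrow> rgerm c Q'"
  unfolding rgerm_def by blast

lemma rgerm_conj: "rgerm c Q \<Longrightarrow> rgerm c Q' \<Longrightarrow> rgerm c (\<lambda>t. Q t \<and> Q' t)"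
  unfolding rgerm_def by (metis min_less_iff_conj)

lemma rgerm_below:
  assumes "rgerm c Q" "c < d"
  obtains e where "c < e" "e \<le> d" "\<And>t. c < t \<Longrightarrow> t < e \<Longrightarrow> Q t"
proof -
  obtain e where "e > c" "\<forall>t. c < t \<and> t < e \<longrightarrow> Q t" using assms(1) unfolding rgerm_def by blast
  then show thesis using that[of "min d e"] assms(2) by simp
qed

text \<open>If \<open>S\<close> has points arbitrarily close to \<open>a\<close> on the right,
  convexity fills the gap between \<open>a\<close> and any one of them.\<close>

lemma rgerm_convex:
  fixes a :: "'a::linorder"
  assumes "\<And>x y z. x \<in> S \<Longrightarrow> z \<in> S \<Longrightarrow> x < y \<Longrightarrow> y < z \<Longrightarrow> y \<in> S" and "a < b"
  shows "rgerm a (\<lambda>t. t \<in> S) \<or> rgerm a (\<lambda>t. t \<notin> S)"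
proof (cases "rgerm a (\<lambda>t. t \<notin> S)")
  case False
  then have ex: "\<exists>t\<in>S. a < t \<and> t < e" if "e > a" for e using that unfolding rgerm_def by blast
  obtain t0 where t0: "t0 \<in> S" "a < t0" using ex[OF assms(2)] by blast
  have "u \<in> S" if "a < u" "u < t0" for u using ex[OF that(1)] assms(1) t0(1) that(2) by blast
  then show ?thesis using t0(2) unfolding rgerm_def by blast
qed simp

lemma rgerm_finite_union:
  fixes a :: "'a::linorder"
  assumes "finite_union_points_intervals S" "a < b"
  shows "rgerm a (\<lambda>t. t \<in> S) \<or> rgerm a (\<lambda>t. t \<notin> S)"
proof -
  obtain F where F: "finite F" "\<forall>J\<in>F. (\<exists>a. J = {a}) \<or> open_interval J" "S = \<Union>F"
    using assms(1) unfolding finite_union_points_intervals_def by blast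
  have "rgerm a (\<lambda>t. t \<in> \<Union>F) \<or> rgerm a (\<lambda>t. t \<notin> \<Union>F)"
    using F(1,2)
  proof (induction F)
    case empty
    then show ?case using assms(2) by (auto simp: rgerm_def)
  next
    case (insert J F)
    have convex: "y \<in> J" if "x \<in> J" "z \<in> J" "x < y" "y < z" for x y z
    proof -
      consider (point) c where "J = {c}" | (interval) "open_interval J" using insert.prems by blast
      then show ?thesis
      proof cases
        case interval
        then obtain c d :: "'a extended" where J: "J = {x. c < Fin x \<and> Fin x < d}"
          unfolding open_interval_def by blast
        have "Fin x < Fin y" "Fin y < Fin z" using that by auto
        then show ?thesis using that(1,2) less_trans unfolding J by blast
      qed (use that in auto)
    qed
    have "rgerm a (\<lambda>t. t \<in> J) \<or> rgerm a (\<lambda>t. t \<notin> J)"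
      by (rule rgerm_convex[OF convex assms(2)])
    then show ?case
    proof
      assume "rgerm a (\<lambda>t. t \<in> J)"
      then have "rgerm a (\<lambda>t. t \<in> \<Union>(insert J F))" by (rule rgerm_mono) simp
      then show ?thesis ..
    next
      assume J: "rgerm a (\<lambda>t. t \<notin> J)"
      have "rgerm a (\<lambda>t. t \<in> \<Union>F) \<or> rgerm a (\<lambda>t. t \<notin> \<Union>F)" using insert by simp
      then show ?thesis
      proof
        assume "rgerm a (\<lambda>t. t \<in> \<Union>F)"
        then have "rgerm a (\<lambda>t. t \<in> \<Union>(insert J F))" by (rule rgerm_mono) simp
        then show ?thesis ..
      next
        assume "rgerm a (\<lambda>t. t \<notin> \<Union>F)"
        then have "rgerm a (\<lambda>t. t \<notin> \<Union>(insert J F))"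
          using J by (rule rgerm_mono[OF rgerm_conj]) simp
        then show ?thesis ..
      qed
    qed
  qed
  then show ?thesis using F(3) by simp
qed

lemma rgerm_open_interval:
  fixes a :: "'a::linorder"
  assumes "open_interval I" "a \<in> I" "a < b"
  shows "rgerm a (\<lambda>t. t \<in> I)"
proof -
  obtain c d :: "'a extended" where I: "I = {x. c < Fin x \<and> Fin x < d}"
    using assms(1) unfolding open_interval_def by blast
  then have a: "c < Fin a" "Fin a < d" using assms(2) by auto
  have c: "c < Fin t" if "a < t" for t using a(1) that by (cases c) auto
  show ?thesis
  proof (cases d)
    case (Fin e)
    then show ?thesis using a c unfolding rgerm_def I by (intro exI[of _ e]) auto
  next
    case Pinf
    then show ?thesis using assms(3) c unfolding rgerm_def I by (intro exI[of _ b]) auto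
  qed (use a in auto)
qed

text \<open>Points of \<open>R\<^sup>n\<^sup>+\<^sup>1\<close> are split as \<open>case_nat t y\<close> with the coordinate \<open>t\<close> at index \<open>0\<close>, not at
  index \<open>n\<close> as in the definition of a definable family.\<close>

primrec germ :: "nat \<Rightarrow> (nat \<Rightarrow> 'a::linorder) \<Rightarrow> ((nat \<Rightarrow> 'a) \<Rightarrow> bool) \<Rightarrow> bool" where
  "germ 0 c P \<longleftrightarrow> P (\<lambda>_. undefined)"
| "germ (Suc n) c P \<longleftrightarrow> germ n (\<lambda>i. c (Suc i)) (\<lambda>y. rgerm (c 0) (\<lambda>t. P (case_nat t y)))"

lemma germ_mono: "germ n c P \<Longrightarrow> (\<And>x. P x \<Longrightarrow> Q x) \<Longrightarrow> germ n c Q"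
proof (induction n arbitrary: c P Q)
  case (Suc n)
  have "rgerm (c 0) (\<lambda>t. Q (case_nat t y))" if "rgerm (c 0) (\<lambda>t. P (case_nat t y))" for y
    using that by (rule rgerm_mono) (rule Suc.prems(2))
  then show ?case
    unfolding germ.simps by (rule Suc.IH[OF Suc.prems(1)[unfolded germ.simps]])
qed simp

lemma germ_conj: "germ n c P \<Longrightarrow> germ n c Q \<Longrightarrow> germ n c (\<lambda>x. P x \<and> Q x)"
proof (induction n arbitrary: c P Q)
  case (Suc n)
  show ?case
    unfolding germ.simps
    by (rule germ_mono[OF Suc.IH[OF Suc.prems[unfolded germ.simps]]]) (simp add: rgerm_conj)
qed simp

text \<open>Density makes the filter of germs proper.\<close>

lemma not_germ_False: "\<not> germ n c (\<lambda>_. False)" for c :: "nat \<Rightarrow> 'a::dense_linorder"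
proof (induction n arbitrary: c)
  case (Suc n)
  have "\<not> rgerm (c 0) (\<lambda>_. False)" unfolding rgerm_def using dense by blast
  then show ?case using Suc by simp
qed simp

section \<open>Boxes\<close>

definition box :: "nat \<Rightarrow> (nat \<Rightarrow> 'a::linorder) \<Rightarrow> (nat \<Rightarrow> 'a) \<Rightarrow> (nat \<Rightarrow> 'a) set" where
  "box n c d = {x \<in> power_space n. \<forall>i<n. c i < x i \<and> x i < d i}"

text \<open>Nondegeneracy of the inner box is included, so \<open>subbox n c d c d\<close> expresses
  that a box is nondegenerate.\<close>

definition subbox :: "nat \<Rightarrow> (nat \<Rightarrow> 'a::linorder) \<Rightarrow> (nat \<Rightarrow> 'a) \<Rightarrow> (nat \<Rightarrow> 'a) \<Rightarrow> (nat \<Rightarrow> 'a) \<Rightarrow> bool" where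
  "subbox n c d c' d' \<longleftrightarrow> (\<forall>i<n. c i \<le> c' i \<and> c' i < d' i \<and> d' i \<le> d i)"

lemma subbox_trans: "subbox n c d c' d' \<Longrightarrow> subbox n c' d' c'' d'' \<Longrightarrow> subbox n c d c'' d''"
  unfolding subbox_def by (meson order_trans)

lemma subbox_refl: "subbox n c d c' d' \<Longrightarrow> subbox n c' d' c' d'"
  unfolding subbox_def by blast

lemma box_mono: "subbox n c d c' d' \<Longrightarrow> box n c' d' \<subseteq> box n c d"
  unfolding subbox_def box_def by fastforce

lemma box_0: "box 0 c d = {\<lambda>_. undefined}"
  by (auto simp: box_def power_space_def)

lemma case_nat_power_space: "case_nat t y \<in> power_space (Suc n) \<longleftrightarrow> y \<in> power_space n"
  by (force simp: power_space_def PiE_def extensional_def split: nat.splits)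

lemma case_nat_box:
  "case_nat t y \<in> box (Suc n) c d \<longleftrightarrow>
    c 0 < t \<and> t < d 0 \<and> y \<in> box n (\<lambda>i. c (Suc i)) (\<lambda>i. d (Suc i))"
  by (auto simp: box_def case_nat_power_space All_less_Suc2 split: nat.split)

lemma box_SucE:
  assumes "x \<in> box (Suc n) c d"
  obtains t y where "x = case_nat t y" "c 0 < t" "t < d 0" "y \<in> box n (\<lambda>i. c (Suc i)) (\<lambda>i. d (Suc i))"
proof -
  have "x = case_nat (x 0) (\<lambda>i. x (Suc i))" by (auto split: nat.split)
  then show thesis using that[of "x 0" "\<lambda>i. x (Suc i)"] assms case_nat_box by metis
qed

lemma subbox_Suc:
  "subbox (Suc n) c d c' d' \<longleftrightarrow> c 0 \<le> c' 0 \<and> c' 0 < d' 0 \<and> d' 0 \<le> d 0 \<and>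
    subbox n (\<lambda>i. c (Suc i)) (\<lambda>i. d (Suc i)) (\<lambda>i. c' (Suc i)) (\<lambda>i. d' (Suc i))"
  by (auto simp: subbox_def All_less_Suc2)

lemma box_nonempty:
  fixes c :: "nat \<Rightarrow> 'a::dense_linorder"
  assumes "subbox n c' d' c d"
  shows "box n c d \<noteq> {}"
proof -
  have "\<forall>i. \<exists>z. i < n \<longrightarrow> c i < z \<and> z < d i" using assms dense unfolding subbox_def by metis
  then obtain z where "\<And>i. i < n \<Longrightarrow> c i < z i \<and> z i < d i" by metis
  then have "restrict z {..<n} \<in> box n c d" by (auto simp: box_def power_space_def)
  then show ?thesis by blast
qed

text \<open>In each coordinate \<open>d i\<close> witnesses the right germ at \<open>c i\<close>.
  The converse, \<open>germ_imp_box\<close>, has to shrink the box.\<close>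

lemma germ_box:
  assumes "subbox n c' d' c d" and "\<And>x. x \<in> box n c d \<Longrightarrow> P x"
  shows "germ n c P"
  using assms
proof (induction n arbitrary: c d c' d' P)
  case (Suc n)
  show ?case
    unfolding germ.simps
  proof (rule Suc.IH)
    show "subbox n (\<lambda>i. c' (Suc i)) (\<lambda>i. d' (Suc i)) (\<lambda>i. c (Suc i)) (\<lambda>i. d (Suc i))"
      using Suc.prems(1) by (simp add: subbox_Suc)
    show "rgerm (c 0) (\<lambda>t. P (case_nat t y))"
      if "y \<in> box n (\<lambda>i. c (Suc i)) (\<lambda>i. d (Suc i))" for y
      unfolding rgerm_def using that Suc.prems
      by (intro exI[of _ "d 0"]) (auto simp: subbox_Suc case_nat_box)
  qed
qed (simp add: box_0)

section \<open>Chains of definable sets covering a box\<close>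

locale dc_locally_o_minimal =
  fixes M :: "('a::{linordered_ab_group_add, dense_linorder}, 'f, 'r) expansion"
  assumes complete: "definably_complete M"
    and lomin: "locally_o_minimal M"
    and nontrivial: "\<exists>r::'a. 0 < r"
begin

lemma greater_ex: "\<exists>b. (a::'a) < b"
  using nontrivial less_add_same_cancel1 by blast

text \<open>Local o-minimality enters here: near \<open>a\<close> the set is a finite union of
  convex sets, each of which is decided to the right of \<open>a\<close>.\<close>

lemma rgerm_dichotomy:
  assumes "dfn M (\<lambda>x. Q (x 0))"
  shows "rgerm a Q \<or> rgerm a (\<lambda>t. \<not> Q t)"
proof -
  obtain b where b: "a < b" using greater_ex by blast
  obtain I where I: "open_interval I" "a \<in> I" "finite_union_points_intervals ({t. Q t} \<inter> I)"
    using lomin definable_subset_of_dfn[OF assms] unfolding locally_o_minimal_def by blast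
  note g = rgerm_conj[OF rgerm_open_interval[OF I(1,2) b]]
  show ?thesis
    using rgerm_finite_union[OF I(3) b]
  proof
    assume "rgerm a (\<lambda>t. t \<in> {t. Q t} \<inter> I)"
    then show ?thesis by (auto elim: rgerm_mono)
  next
    assume "rgerm a (\<lambda>t. t \<notin> {t. Q t} \<inter> I)"
    then have "rgerm a (\<lambda>t. \<not> Q t)" by (rule rgerm_mono[OF g]) blast
    then show ?thesis ..
  qed
qed

text \<open>The infimum given by definable completeness is finite, as it lies between
  \<open>l\<close> and \<open>t\<close>.\<close>

lemma infimum_ex:
  assumes "dfn M (\<lambda>x. Q (x 0))" and "Q t" and "\<And>t. Q t \<Longrightarrow> l \<le> t"
  obtains m where "\<And>t. Q t \<Longrightarrow> m \<le> t" "\<And>w. m < w \<Longrightarrow> \<exists>t. Q t \<and> t < w"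
proof -
  obtain s :: "'a extended" where s: "isGlb UNIV (Fin ` {t. Q t}) s"
    using complete definable_subset_of_dfn[OF assms(1)] unfolding definably_complete_def by blast
  have lb: "s \<le> Fin t" if "Q t" for t
    using s that by (auto simp: isGlb_def greatestP_def isLb_def setge_def)
  have gr: "z \<le> s" if "\<And>t. Q t \<Longrightarrow> z \<le> Fin t" for z
    using s that by (auto simp: isGlb_def greatestP_def isLb_def setge_def setle_def)
  have "Fin l \<le> s" using gr assms(3) by simp
  moreover have "s \<le> Fin t" using lb assms(2) by simp
  ultimately obtain m where m: "s = Fin m" by (cases s) auto
  show thesis
  proof
    show "m \<le> t" if "Q t" for t using lb[OF that] m by simp
    show "\<exists>t. Q t \<and> t < w" if "m < w" for w
    proof (rule ccontr)
      assume "\<not> ?thesis"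
      then have "Fin w \<le> s" by (intro gr) (auto simp: not_less)
      then show False using that m by simp
    qed
  qed
qed

section \<open>The one-dimensional case\<close>

lemma baire_interval:
  assumes X: "dfn M (\<lambda>x. X (x 0) (x (Suc 0)))"
    and chain: "\<And>r s. X r \<le> X s \<or> X s \<le> X r"
    and ab: "a < b" and cover: "\<And>t. a < t \<Longrightarrow> t < b \<Longrightarrow> \<exists>r. X r t"
  shows "\<exists>r u v. a \<le> u \<and> u < v \<and> v \<le> b \<and> (\<forall>t. u < t \<and> t < v \<longrightarrow> X r t)"
proof (rule ccontr)
  assume neg: "\<not> ?thesis"
  have fib: "dfn M (\<lambda>x. X r (x 0))" for r
    using dfn_subst[OF X, of "\<lambda>i. if i = 0 then (\<lambda>_. r) else (\<lambda>x. x 0)"]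
    by (simp add: dvar_proj dvar_const)
  have discrete: "rgerm c (\<lambda>t. \<not> X r t)" if c: "a \<le> c" "c < b" for c r
  proof -
    have "\<not> rgerm c (X r)"
    proof
      assume "rgerm c (X r)"
      from rgerm_below[OF this c(2)] obtain e
        where "c < e" "e \<le> b" "\<And>t. c < t \<Longrightarrow> t < e \<Longrightarrow> X r t" by blast
      then show False using neg c(1) by blast
    qed
    then show ?thesis using rgerm_dichotomy[OF fib] by blast
  qed
  define D where "D t \<longleftrightarrow> (\<exists>r. X r t \<and> (\<forall>u. a < u \<longrightarrow> u < t \<longrightarrow> \<not> X r u))" for t
  have X2: "dfn M (\<lambda>x. X (x i) (x j))" for i j
    using dfn_subst[OF X, of "\<lambda>k. if k = 0 then (\<lambda>x. x i) else (\<lambda>x. x j)"]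
    by (simp add: dvar_proj)
  have dD: "dfn M (\<lambda>x. D (x 0))"
    unfolding D_def by (intro dfn_intros X2)
  have ex: "\<exists>t. a < t \<and> t < e \<and> D t" if e: "a < e" for e
  proof -
    have "a < min e b" using e ab by simp
    then obtain t1 where t1: "a < t1" "t1 < e" "t1 < b" using dense[of a "min e b"] by auto
    obtain r where r: "X r t1" using cover t1 by blast
    \<comment> \<open>As \<open>(a, c)\<close> misses \<open>X r\<close>, the infimum
      \<open>m\<close> of the part of \<open>X r\<close> to the right of \<open>a\<close> is greater
      than \<open>a\<close>.\<close>
    obtain c where c: "c > a" "\<And>t. a < t \<Longrightarrow> t < c \<Longrightarrow> \<not> X r t"
      using discrete[of a r] ab unfolding rgerm_def by auto
    have cl: "c \<le> t" if "a < t \<and> X r t" for t using c(2)[of t] that by force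
    have "dfn M (\<lambda>x. a < x 0 \<and> X r (x 0))" by (intro dfn_intros fib)
    then obtain m where m: "\<And>t. a < t \<and> X r t \<Longrightarrow> m \<le> t"
        "\<And>w. m < w \<Longrightarrow> \<exists>t. (a < t \<and> X r t) \<and> t < w"
      using infimum_ex[of "\<lambda>t. a < t \<and> X r t" t1 c] r t1 cl by auto
    have "c \<le> m" using m(2)[of c] cl by force
    then have am: "a < m" using c by simp
    have mt: "m \<le> t1" using m(1) r t1 by blast
    \<comment> \<open>Otherwise points of \<open>X r\<close> would accumulate at \<open>m\<close>
      from the right, against discreteness. So \<open>m\<close> is a least element.\<close>
    have "X r m"
    proof (rule ccontr)
      assume nm: "\<not> X r m"
      obtain c' where c': "c' > m" "\<And>t. m < t \<Longrightarrow> t < c' \<Longrightarrow> \<not> X r t"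
        using discrete[OF less_imp_le[OF am] le_less_trans[OF mt t1(3)], of r]
        unfolding rgerm_def by blast
      obtain t where t: "a < t" "X r t" "t < c'" using m(2) c'(1) by blast
      then have "m \<le> t" using m(1) by blast
      then show False using t nm c'(2)[of t] by (cases "t = m") auto
    qed
    moreover have "\<not> X r u" if "a < u" "u < m" for u using m(1)[of u] that by auto
    ultimately have "D m" unfolding D_def by blast
    then show ?thesis using am mt t1 by (meson le_less_trans)
  qed
  have "\<not> rgerm a (\<lambda>t. \<not> D t)" using ex unfolding rgerm_def by blast
  then have "rgerm a D" using rgerm_dichotomy[OF dD] by blast
  from rgerm_below[OF this ab] obtain e
    where e: "a < e" "e \<le> b" "\<And>t. a < t \<Longrightarrow> t < e \<Longrightarrow> D t" by blast
  obtain y where y: "a < y" "y < e" using dense e(1) by blast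
  obtain s where s: "X s y" using e(3)[OF y] unfolding D_def by blast
  have "X s x" if x: "y < x" "x < e" for x
  proof -
    obtain r where r: "X r x" "\<not> X r y" using e(3)[of x] x y unfolding D_def by force
    then show ?thesis using chain[of r s] s by auto
  qed
  then show False using neg y e(2) by (meson less_imp_le)
qed

section \<open>Definability of germs and the ultrafilter property\<close>

lemma dfn_rgerm_fibre:
  assumes "dfn M (\<lambda>x. P (x 0) (\<lambda>i. x (Suc i)))"
  shows "dfn M (\<lambda>x. rgerm c (\<lambda>t. P (x 0) (case_nat t (\<lambda>i. x (Suc i)))))"
  unfolding rgerm_def by (intro dfn_intros dfn_family_subst[OF assms])

text \<open>For fixed \<open>n\<close> a germ is a finite string of quantifiers. Uniformity in the
  index \<open>x 0\<close> allows an infimum over the indices whose member belongs to the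
  ultrafilter.\<close>

lemma dfn_germ:
  assumes "dfn M (\<lambda>x. P (x 0) (\<lambda>i. x (Suc i)))"
  shows "dfn M (\<lambda>x. germ n c (P (x 0)))"
  using assms
proof (induction n arbitrary: c P)
  case 0
  show ?case unfolding germ.simps by (intro dfn_intros dfn_family_subst[OF 0])
next
  case (Suc n)
  show ?case unfolding germ.simps by (rule Suc.IH[OF dfn_rgerm_fibre[OF Suc.prems]])
qed

lemma dfn_rgerm:
  assumes "dfn M P"
  shows "dfn M (\<lambda>y. rgerm c (\<lambda>t. P (case_nat t y)))"
  unfolding rgerm_def by (intro dfn_intros dfn_subst[OF assms])

text \<open>The dichotomy decides the innermost coordinate for each fixed choice of the others;
  induction handles the rest.\<close>

lemma germ_not:
  assumes "dfn M P" "\<not> germ n c P"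
  shows "germ n c (\<lambda>x. \<not> P x)"
  using assms
proof (induction n arbitrary: c P)
  case (Suc n)
  have "germ n (\<lambda>i. c (Suc i)) (\<lambda>y. \<not> rgerm (c 0) (\<lambda>t. P (case_nat t y)))"
    using Suc.IH[OF dfn_rgerm[OF Suc.prems(1)]] Suc.prems(2) by simp
  moreover have "rgerm (c 0) (\<lambda>t. \<not> P (case_nat t y))" if "\<not> rgerm (c 0) (\<lambda>t. P (case_nat t y))" for y
    using rgerm_dichotomy[of "\<lambda>t. P (case_nat t y)" "c 0"] that
      dfn_subst[OF Suc.prems(1), of "\<lambda>i x. case_nat (x 0) y i"]
    by (simp add: dvar_case_nat dvar_proj dvar_const)
  ultimately show ?case unfolding germ.simps by (rule germ_mono)
qed simp

section \<open>Induction on the dimension\<close>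

text \<open>Comparability of members replaces monotonicity in the index. Thus auxiliary families
  indexed by endpoints or lengths qualify, even if decreasing or empty at some indices.\<close>

definition baire :: "nat \<Rightarrow> bool" where
  "baire n \<longleftrightarrow> (\<forall>X c d. dfn M (\<lambda>x. X (x 0) (\<lambda>i. x (Suc i))) \<longrightarrow> (\<forall>r s. X r \<le> X s \<or> X s \<le> X r) \<longrightarrow>
     subbox n c d c d \<longrightarrow> (\<forall>x\<in>box n c d. \<exists>r. X r x) \<longrightarrow>
     (\<exists>r c' d'. subbox n c d c' d' \<and> (\<forall>x\<in>box n c' d'. X r x)))"

lemma baireD:
  assumes "baire n" "dfn M (\<lambda>x. X (x 0) (\<lambda>i. x (Suc i)))" "\<And>r s. X r \<le> X s \<or> X s \<le> X r"
    "subbox n c d c d" "\<And>x. x \<in> box n c d \<Longrightarrow> \<exists>r. X r x"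
  shows "\<exists>r c' d'. subbox n c d c' d' \<and> (\<forall>x\<in>box n c' d'. X r x)"
  using assms(1)[unfolded baire_def, rule_format, of X c d] assms(2-) by blast

text \<open>Over a smaller base, each fibre satisfies \<open>P\<close> on an interval starting at
  \<open>c 0\<close>. The base points for which a given right end works form a chain, so the Baire
  property of the base yields a common right end.\<close>

lemma germ_imp_box:
  assumes "\<And>m. m < n \<Longrightarrow> baire m" "dfn M P" "subbox n c d c d" "germ n c P"
  shows "\<exists>c' d'. subbox n c d c' d' \<and> (\<forall>x\<in>box n c' d'. P x)"
  using assms
proof (induction n arbitrary: c d P)
  case 0
  then show ?case by (auto simp: subbox_def box_0)
next
  case (Suc n)
  let ?c = "\<lambda>i. c (Suc i)" and ?d = "\<lambda>i. d (Suc i)"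
  have cd: "c 0 < d 0" "subbox n ?c ?d ?c ?d" using Suc.prems(3) by (auto simp: subbox_Suc)
  obtain c1 d1 where 1: "subbox n ?c ?d c1 d1"
      "\<And>y. y \<in> box n c1 d1 \<Longrightarrow> rgerm (c 0) (\<lambda>t. P (case_nat t y))"
    using Suc.IH[OF _ dfn_rgerm[OF Suc.prems(2)] cd(2), of "c 0"] Suc.prems(1,4) by auto
  \<comment> \<open>The bounds on \<open>e\<close> keep the interval inside
    \<open>(c 0, d 0)\<close>. Within them \<open>S e\<close> shrinks as \<open>e\<close> grows;
    outside them it is empty.\<close>
  define S where "S e y \<longleftrightarrow> c 0 < e \<and> e \<le> d 0 \<and> (\<forall>t. c 0 < t \<longrightarrow> t < e \<longrightarrow> P (case_nat t y))" for e y
  have dS: "dfn M (\<lambda>x. S (x 0) (\<lambda>i. x (Suc i)))"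
    unfolding S_def by (intro dfn_intros dfn_subst[OF Suc.prems(2)])
  have chain: "S e \<le> S e' \<or> S e' \<le> S e" for e e'
  proof (cases "c 0 < e \<and> e \<le> d 0 \<and> c 0 < e' \<and> e' \<le> d 0")
    case True
    then show ?thesis unfolding S_def by (cases "e \<le> e'") (auto simp: le_fun_def)
  qed (auto simp: S_def le_fun_def)
  have cov: "\<exists>e. S e y" if "y \<in> box n c1 d1" for y
    using rgerm_below[OF 1(2)[OF that] cd(1)] unfolding S_def by metis
  have B: "baire n" using Suc.prems(1) by simp
  obtain e c2 d2 where 2: "subbox n c1 d1 c2 d2" "\<And>y. y \<in> box n c2 d2 \<Longrightarrow> S e y"
    using baireD[where X = S, OF B dS chain subbox_refl[OF 1(1)] cov] by blast
  obtain y0 where "y0 \<in> box n c2 d2" using box_nonempty[OF 2(1)] by blast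
  from 2(2)[OF this] have e: "c 0 < e" "e \<le> d 0" by (simp_all add: S_def)
  have "subbox (Suc n) c d (case_nat (c 0) c2) (case_nat e d2)"
    using e subbox_trans[OF 1(1) 2(1)] by (simp add: subbox_Suc)
  moreover have "P x" if "x \<in> box (Suc n) (case_nat (c 0) c2) (case_nat e d2)" for x
    using that 2(2) unfolding S_def by (auto elim!: box_SucE)
  ultimately show ?case by blast
qed

text \<open>The group need not be divisible. Writing \<open>s = z + (s - z)\<close> with both
  summands positive, any positive element below both serves in place of a half.\<close>

lemma half_ex:
  assumes "0 < (s::'a)"
  obtains e where "0 < e" "e + e < s"
proof -
  obtain z where z: "0 < z" "z < s" using dense assms by blast
  then obtain e where e: "0 < e" "e < min z (s - z)" using dense[of 0 "min z (s - z)"] by auto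
  then have "e + e < z + (s - z)" by (intro add_strict_mono) auto
  then show thesis using that e by simp
qed

text \<open>If every fibre contains an interval, then by the induction hypothesis the length \<open>s\<close> of the
  intervals is uniform on a smaller box. Their leftmost starting points vary by less than
  \<open>s\<close> near the corner \<open>c\<close>: they are close to the infimum of the \<open>w\<close> such that near the
  corner an interval starts before \<open>w\<close>.\<close>

lemma interval_fibres_imp_box:
  assumes B: "\<And>m. m \<le> n \<Longrightarrow> baire m" and P: "dfn M P"
    and cd: "subbox n c d c d"
    and fib: "\<And>y. y \<in> box n c d \<Longrightarrow>
      \<exists>u v. a \<le> u \<and> u < v \<and> v \<le> b \<and> (\<forall>t. u < t \<and> t < v \<longrightarrow> P (case_nat t y))"
  shows "\<exists>u v c' d'. a \<le> u \<and> u < v \<and> v \<le> b \<and> subbox n c d c' d' \<and>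
    (\<forall>y\<in>box n c' d'. \<forall>t. u < t \<and> t < v \<longrightarrow> P (case_nat t y))"
proof -
  \<comment> \<open>Recording intervals by start and length makes lengths comparable across fibres:
    \<open>S s\<close> shrinks as the positive number \<open>s\<close> grows.\<close>
  define S where "S s y \<longleftrightarrow> 0 < s \<and> (\<exists>u. a \<le> u \<and> u + s \<le> b \<and>
    (\<forall>t. u < t \<longrightarrow> t < u + s \<longrightarrow> P (case_nat t y)))" for s y
  have dS: "dfn M (\<lambda>x. S (x 0) (\<lambda>i. x (Suc i)))"
    unfolding S_def by (intro dfn_intros dfn_subst[OF P])
  have anti: "S s y" if S: "S s' y" and s: "0 < s" "s \<le> s'" for s s' y
  proof -
    obtain u where u: "a \<le> u" "u + s' \<le> b" "\<And>t. u < t \<Longrightarrow> t < u + s' \<Longrightarrow> P (case_nat t y)"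
      using S unfolding S_def by blast
    have le: "u + s \<le> u + s'" using s(2) by simp
    have "u + s \<le> b" using le u(2) by (rule order_trans)
    moreover have "P (case_nat t y)" if "u < t" "t < u + s" for t
      using u(3)[OF that(1) less_le_trans[OF that(2) le]] .
    ultimately show ?thesis unfolding S_def using u(1) s(1) by blast
  qed
  have chain: "S s \<le> S s' \<or> S s' \<le> S s" for s s'
  proof (cases "0 < s \<and> 0 < s'")
    case True
    then show ?thesis using anti linear[of s s'] by (auto simp: le_fun_def)
  qed (auto simp: S_def le_fun_def)
  have cov: "\<exists>s. S s y" if y: "y \<in> box n c d" for y
  proof -
    obtain u v where "a \<le> u" "u < v" "v \<le> b" "\<And>t. u < t \<Longrightarrow> t < v \<Longrightarrow> P (case_nat t y)"
      using fib[OF y] by blast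
    then have "S (v - u) y" unfolding S_def by (auto intro!: exI[of _ u])
    then show ?thesis by blast
  qed
  obtain s c1 d1 where 1: "subbox n c d c1 d1" "\<And>y. y \<in> box n c1 d1 \<Longrightarrow> S s y"
    using baireD[where X = S, OF B[OF order_refl] dS chain cd cov] by blast
  obtain y1 where "y1 \<in> box n c1 d1" using box_nonempty[OF 1(1)] by blast
  from 1(2)[OF this] have s: "0 < s" by (simp add: S_def)
  \<comment> \<open>The length \<open>s\<close> is now fixed, and \<open>w\<close> bounds the
    starting point from above.\<close>
  define G where "G w y \<longleftrightarrow> (\<exists>u. u < w \<and> a \<le> u \<and> u + s \<le> b \<and>
    (\<forall>t. u < t \<longrightarrow> t < u + s \<longrightarrow> P (case_nat t y)))" for w y
  have dG: "dfn M (\<lambda>x. G (x 0) (\<lambda>i. x (Suc i)))"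
    unfolding G_def by (intro dfn_intros dfn_subst[OF P])
  have dGw: "dfn M (G w)" for w
    using dfn_family_subst[OF dG, of "\<lambda>_. w" "\<lambda>i x. x i"] by (simp add: dvar_proj dvar_const)
  have "G b y" if y: "y \<in> box n c1 d1" for y
  proof -
    obtain u where u: "a \<le> u" "u + s \<le> b" "\<And>t. u < t \<Longrightarrow> t < u + s \<Longrightarrow> P (case_nat t y)"
      using 1(2)[OF y] unfolding S_def by blast
    have "u < u + s" using s by simp
    then have "u < b" using u(2) by (rule less_le_trans)
    then show ?thesis unfolding G_def using u by blast
  qed
  then have Wb: "germ n c1 (G b)" using germ_box[OF 1(1)] by blast
  have lower: "a \<le> w" if "germ n c1 (G w)" for w
  proof (rule ccontr)
    assume "\<not> a \<le> w"
    then have "G w = (\<lambda>_. False)" unfolding G_def by (auto simp: fun_eq_iff)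
    then show False using that not_germ_False[of n c1] by simp
  qed
  obtain m where m: "\<And>w. germ n c1 (G w) \<Longrightarrow> m \<le> w"
      "\<And>w. m < w \<Longrightarrow> \<exists>t. germ n c1 (G t) \<and> t < w"
    using infimum_ex[OF dfn_germ[OF dG] Wb lower] by blast
  \<comment> \<open>With \<open>e + e < s\<close>, intervals of length \<open>s\<close> starting in
    \<open>[m - e, m + e)\<close> have the nonempty interval \<open>(m + e, m - e + s)\<close> in
    common.\<close>
  obtain e where e: "0 < e" "e + e < s" using half_ex[OF s] by blast
  obtain w where w: "germ n c1 (G w)" "w < m + e" using m(2)[of "m + e"] e(1) by auto
  have "G (m + e) y" if "G w y" for y
    using that less_trans[OF _ w(2)] unfolding G_def by blast
  then have "germ n c1 (G (m + e))" by (rule germ_mono[OF w(1)])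
  \<comment> \<open>As \<open>m - e\<close> lies below the infimum, \<open>G (m - e)\<close> is not
    in the ultrafilter, so its complement is.\<close>
  moreover have "\<not> germ n c1 (G (m - e))" using m(1)[of "m - e"] e(1) by auto
  then have "germ n c1 (\<lambda>y. \<not> G (m - e) y)" by (rule germ_not[OF dGw])
  ultimately have g: "germ n c1 (\<lambda>y. G (m + e) y \<and> \<not> G (m - e) y)" by (rule germ_conj)
  have "dfn M (\<lambda>y. G (m + e) y \<and> \<not> G (m - e) y)" by (intro dfn_intros dGw)
  then obtain c2 d2 where 2: "subbox n c1 d1 c2 d2"
      "\<And>y. y \<in> box n c2 d2 \<Longrightarrow> G (m + e) y \<and> \<not> G (m - e) y"
    using germ_imp_box[OF B[OF less_imp_le] _ subbox_refl[OF 1(1)] g] by blast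
  have key: "\<exists>u. m - e \<le> u \<and> u < m + e \<and> a \<le> u \<and> u + s \<le> b \<and>
      (\<forall>t. u < t \<longrightarrow> t < u + s \<longrightarrow> P (case_nat t y))" if "y \<in> box n c2 d2" for y
    using 2(2)[OF that] not_less[of _ "m - e"] unfolding G_def by blast
  obtain y where y: "y \<in> box n c2 d2" using box_nonempty[OF 2(1)] by blast
  obtain u where u: "m - e \<le> u" "u < m + e" "a \<le> u" "u + s \<le> b" using key[OF y] by blast
  have "a \<le> m + e" using u by simp
  moreover have "m + e < m - e + s" using e(2) by (simp add: algebra_simps)
  moreover have "m - e + s \<le> b" using u(1,4) by (meson add_right_mono order_trans)
  moreover have "subbox n c d c2 d2" using subbox_trans[OF 1(1) 2(1)] .
  moreover have "P (case_nat t y)" if y: "y \<in> box n c2 d2" and t: "m + e < t" "t < m - e + s" for y t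
  proof -
    obtain u where u: "m - e \<le> u" "u < m + e" "\<And>t. u < t \<Longrightarrow> t < u + s \<Longrightarrow> P (case_nat t y)"
      using key[OF y] by blast
    have "m - e + s \<le> u + s" using u(1) by (rule add_right_mono)
    then show ?thesis using u(3)[OF less_trans[OF u(2) t(1)] less_le_trans[OF t(2)]] by blast
  qed
  ultimately show ?thesis by blast
qed

lemma baire: "baire n"
proof (induction n rule: less_induct)
  case (less n)
  show ?case
  proof (cases n)
    case 0
    then show ?thesis by (auto simp: baire_def subbox_def box_0)
  next
    case (Suc n')
    \<comment> \<open>All smaller dimensions are required, since \<open>germ_imp_box\<close>
      enlarges the base one coordinate at a time.\<close>
    have B: "\<And>m. m \<le> n' \<Longrightarrow> baire m" using less Suc by simp
    show ?thesis
      unfolding baire_def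
    proof (intro allI impI)
      fix X :: "'a \<Rightarrow> (nat \<Rightarrow> 'a) \<Rightarrow> bool" and c d
      assume X: "dfn M (\<lambda>x. X (x 0) (\<lambda>i. x (Suc i)))" and chain: "\<forall>r s. X r \<le> X s \<or> X s \<le> X r"
        and cd: "subbox n c d c d" and cover: "\<forall>x\<in>box n c d. \<exists>r. X r x"
      let ?c = "\<lambda>i. c (Suc i)" and ?d = "\<lambda>i. d (Suc i)"
      have cd': "c 0 < d 0" "subbox n' ?c ?d ?c ?d" using cd Suc by (auto simp: subbox_Suc)
      \<comment> \<open>\<open>T\<close> is a chain over the base, which it covers because
        \<open>baire_interval\<close> applies to every fibre. The induction hypothesis then fixes
        one \<open>r\<close> over a smaller base.\<close>
      define T where "T r y \<longleftrightarrow> (\<exists>u v. c 0 \<le> u \<and> u < v \<and> v \<le> d 0 \<and>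
        (\<forall>t. u < t \<and> t < v \<longrightarrow> X r (case_nat t y)))" for r y
      have dT: "dfn M (\<lambda>x. T (x 0) (\<lambda>i. x (Suc i)))"
        unfolding T_def by (intro dfn_intros dfn_family_subst[OF X])
      have mono: "T r \<le> T s" if "X r \<le> X s" for r s
        using that unfolding T_def le_fun_def le_bool_def by blast
      then have chainT: "T r \<le> T s \<or> T s \<le> T r" for r s using chain by blast
      have cov: "\<exists>r. T r y" if y: "y \<in> box n' ?c ?d" for y
        unfolding T_def
      proof (rule baire_interval[of "\<lambda>r t. X r (case_nat t y)"])
        show "dfn M (\<lambda>x. X (x 0) (case_nat (x (Suc 0)) y))"
          by (intro dfn_intros dfn_family_subst[OF X])
        show "(\<lambda>t. X r (case_nat t y)) \<le> (\<lambda>t. X s (case_nat t y)) \<or>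
            (\<lambda>t. X s (case_nat t y)) \<le> (\<lambda>t. X r (case_nat t y))" for r s
          using chain unfolding le_fun_def by blast
        show "\<exists>r. X r (case_nat t y)" if "c 0 < t" "t < d 0" for t
          using cover that y Suc by (simp add: case_nat_box)
      qed (rule cd')
      obtain r c1 d1 where 1: "subbox n' ?c ?d c1 d1" "\<And>y. y \<in> box n' c1 d1 \<Longrightarrow> T r y"
        using baireD[where X = T, OF B[OF order_refl] dT chainT cd'(2) cov] by blast
      have Xr: "dfn M (X r)"
        using dfn_family_subst[OF X, of "\<lambda>_. r" "\<lambda>i x. x i"] by (simp add: dvar_proj dvar_const)
      from interval_fibres_imp_box[OF B Xr subbox_refl[OF 1(1)] 1(2)[unfolded T_def]]
      obtain u v c2 d2 where 2: "c 0 \<le> u" "u < v" "v \<le> d 0" "subbox n' c1 d1 c2 d2"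
          "\<And>y t. y \<in> box n' c2 d2 \<Longrightarrow> u < t \<and> t < v \<Longrightarrow> X r (case_nat t y)" by blast
      have "subbox n c d (case_nat u c2) (case_nat v d2)"
        using 2 subbox_trans[OF 1(1) 2(4)] Suc by (simp add: subbox_Suc)
      moreover have "X r x" if "x \<in> box n (case_nat u c2) (case_nat v d2)" for x
        using that 2(5) unfolding Suc by (auto elim!: box_SucE)
      ultimately show "\<exists>r c' d'. subbox n c d c' d' \<and> (\<forall>x\<in>box n c' d'. X r x)" by blast
    qed
  qed
qed

end

section \<open>Boxes and the product topology\<close>

lemma openin_box: "openin (power_topology n) (box n c d)" for c :: "nat \<Rightarrow> 'a::linorder_topology"
proof -
  have "box n c d = (\<Pi>\<^sub>E i\<in>{..<n}. {c i<..<d i})"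
    by (auto simp: box_def power_space_def PiE_def Pi_def)
  then show ?thesis
    unfolding power_topology_def by (simp add: openin_PiE_gen)
qed

lemma open_contains_interval:
  fixes x :: "'a::{linordered_ab_group_add, linorder_topology}"
  assumes "open U" "x \<in> U" "(0::'a) < r"
  shows "\<exists>a b. a < x \<and> x < b \<and> {a<..<b} \<subseteq> U"
proof -
  have "x - r < x" "x < x + r" using assms(3) by auto
  then obtain a b where ab: "a < x" "{a<..x} \<subseteq> U" "x < b" "{x..<b} \<subseteq> U"
    using open_left[OF assms(1,2)] open_right[OF assms(1,2)] by metis
  then have "{a<..<b} \<subseteq> U" by (auto simp: subset_iff) (meson linear not_less)
  then show ?thesis using ab by blast
qed

lemma openin_contains_box:
  fixes U :: "(nat \<Rightarrow> 'a::{linordered_ab_group_add, linorder_topology}) set"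
  assumes "openin (power_topology n) U" "x \<in> U" "(0::'a) < r"
  shows "\<exists>c d. subbox n c d c d \<and> box n c d \<subseteq> U"
proof -
  obtain V where V: "\<And>i. i < n \<Longrightarrow> open (V i)" "x \<in> Pi\<^sub>E {..<n} V" "Pi\<^sub>E {..<n} V \<subseteq> U"
    using assms(1,2) unfolding power_topology_def openin_product_topology_alt
    by (metis lessThan_iff open_openin)
  have "\<forall>i. \<exists>a b. i < n \<longrightarrow> a < x i \<and> x i < b \<and> {a<..<b} \<subseteq> V i"
    using open_contains_interval[OF V(1) _ assms(3)] V(2) by (metis PiE_mem lessThan_iff)
  then obtain c d where cd: "\<And>i. i < n \<Longrightarrow> c i < x i \<and> x i < d i \<and> {c i<..<d i} \<subseteq> V i" by metis
  then have "subbox n c d c d" unfolding subbox_def by (meson less_trans order_refl)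
  moreover have "box n c d \<subseteq> Pi\<^sub>E {..<n} V"
    using cd unfolding box_def power_space_def PiE_def Pi_def
    by (auto simp: subset_iff)
  ultimately show ?thesis using V(3) by blast
qed

theorem theorem4p3:
  fixes M :: "('a::{linordered_ab_group_add, dense_linorder, linorder_topology}, 'f, 'r) expansion"
  assumes "definably_complete M"
    and "uniformly_locally_o_minimal_second_kind M"
  shows "definably_baire M"
  unfolding definably_baire_def
proof (intro allI impI)
  fix n and X :: "'a \<Rightarrow> (nat \<Rightarrow> 'a) set"
  assume fam: "definable_increasing_family M n X"
    and nwd: "\<forall>r>0. power_topology n interior_of (power_topology n closure_of X r) = {}"
  show "power_topology n interior_of (\<Union>r\<in>{0<..}. X r) = {}"
  proof (rule ccontr)
    assume "\<not> ?thesis"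
    then obtain x U where U: "openin (power_topology n) U" "x \<in> U" "U \<subseteq> (\<Union>r\<in>{0<..}. X r)"
      unfolding interior_of_def by blast
    \<comment> \<open>The point \<open>x\<close> lies in a member with positive index, so the group
      is nontrivial, as the locale requires.\<close>
    then obtain r0 :: 'a where r0: "0 < r0" by fastforce
    have "locally_o_minimal M"
      using assms(2) unfolding uniformly_locally_o_minimal_second_kind_def by (rule conjunct1)
    then interpret dc_locally_o_minimal M
      using assms(1) r0 by unfold_locales blast+
    obtain A where A: "definable M (Suc n) A" "\<And>r. r > 0 \<Longrightarrow> X r = {x \<in> power_space n. x(n := r) \<in> A}"
      and inc: "\<And>r r'. 0 < r \<Longrightarrow> r < r' \<Longrightarrow> X r \<subseteq> X r'"
      using fam unfolding definable_increasing_family_def by blast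
    \<comment> \<open>The family is extended to all indices by empty members, and to all sequences
      by restriction.\<close>
    define Y where "Y r x \<longleftrightarrow> 0 < r \<and> restrict x {..<n} \<in> X r" for r x
    \<comment> \<open>The index moves from coordinate \<open>n\<close> of \<open>A\<close> to
      position \<open>0\<close>.\<close>
    have "restrict (\<lambda>i. if i < n then x (Suc i) else x 0) {..<Suc n}
        = (restrict (\<lambda>i. x (Suc i)) {..<n})(n := x 0)" for x :: "nat \<Rightarrow> 'a"
      by (auto simp: fun_eq_iff)
    then have "Y (x 0) (\<lambda>i. x (Suc i)) \<longleftrightarrow> 0 < x 0 \<and>
        restrict (\<lambda>i. if i < n then x (Suc i) else x 0) {..<Suc n} \<in> A" for x
      by (auto simp: Y_def A(2) power_space_def)
    moreover have "dvar (\<lambda>x. if i < n then x (Suc i) else x 0)" for i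
      by (cases "i < n") (simp_all add: dvar_proj)
    then have "dfn M (\<lambda>x. 0 < x 0 \<and>
        restrict (\<lambda>i. if i < n then x (Suc i) else x 0) {..<Suc n} \<in> A)"
      by (intro dfn_intros dfn_subst[OF dfn_of_definable[OF A(1)]])
    ultimately have dY: "dfn M (\<lambda>x. Y (x 0) (\<lambda>i. x (Suc i)))" by simp
    have chain: "Y r \<le> Y s \<or> Y s \<le> Y r" for r s
    proof (cases "0 < r \<and> 0 < s")
      case True
      then show ?thesis using inc[of r s] inc[of s r]
        by (cases r s rule: linorder_cases) (auto simp: Y_def le_fun_def)
    qed (auto simp: Y_def le_fun_def)
    have Y: "Y r x \<longleftrightarrow> 0 < r \<and> x \<in> X r" if "x \<in> box n c d" for r x c d
    proof -
      have "restrict x {..<n} = x" using that by (auto simp: box_def power_space_def PiE_restrict)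
      then show ?thesis by (simp add: Y_def)
    qed
    obtain c d where cd: "subbox n c d c d" "box n c d \<subseteq> U"
      using openin_contains_box[OF U(1,2) r0] by blast
    have cov: "\<exists>r. Y r x" if "x \<in> box n c d" for x
      using that cd(2) U(3) Y by (metis UN_E greaterThan_iff subsetD)
    obtain r c' d' where sub: "subbox n c d c' d'" and 1: "\<And>x. x \<in> box n c' d' \<Longrightarrow> Y r x"
      using baireD[where X = Y, OF baire dY chain cd(1) cov] by blast
    have ne: "box n c' d' \<noteq> {}" using box_nonempty[OF sub] .
    \<comment> \<open>A point of the box excludes the indices where \<open>Y\<close> is
      empty.\<close>
    then have r: "0 < r" using 1 Y by blast
    have "box n c' d' \<subseteq> X r" using 1 Y by blast
    moreover have "X r \<subseteq> topspace (power_topology n)"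
      using A(2)[OF r] by (auto simp: power_topology_def power_space_def)
    ultimately have "box n c' d' \<subseteq> power_topology n closure_of X r"
      using closure_of_subset by blast
    then have "box n c' d' \<subseteq> power_topology n interior_of (power_topology n closure_of X r)"
      by (rule interior_of_maximal[OF _ openin_box])
    then show False using nwd r ne by simp
  qed
qed

end
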